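(* Let $X$ be an infinite connected Hausdorff space. Then $X$ is weakly cyclically orderable if and only if $X\setminus\{p\}$ has a continuous weak selection for every $p\in X$.
   Context: For a topological space $Z$, $\mathscr{F}_2(Z)$ is the set of all nonempty closed subsets $S$ of $Z$ with $|S|\leq 2$, endowed with the (relative) Vietoris topology, i.e. the topology generated by all collections $\langle\mathscr{V}\rangle=\{S\in\mathscr{F}_2(Z): S\subset\bigcup\mathscr{V}\text{ and }S\cap V\neq\varnothing\text{ for every }V\in\mathscr{V}\}$, where $\mathscr{V}$ runs over the finite families of open subsets of $Z$. A weak selection for $Z$ is a map $\sigma:\mathscr{F}_2(Z)\to Z$ with $\sigma(S)\in S$ for all $S\in\mathscr{F}_2(Z)$; it is continuous if it is continuous with respect to the Vietoris topology on $\mathscr{F}_2(Z)$. The set $X\setminus\{p\}$ carries the subspace topology. A cyclic order on a set $X$ is a ternary relation $\mathbf{C}\subset X^3$ such that for all $a,b,c,d\in X$: (i) ($a,b,c$ are pairwise distinct and $(a,b,c)\notin\mathbf{C}$) if and only if $(c,b,a)\in\mathbf{C}$; (ii) $(a,b,c)\in\mathbf{C}$ implies $(b,c,a)\in\mathbf{C}$; (iii) $(a,b,c)\in\mathbf{C}$ and $(a,c,d)\in\mathbf{C}$ imply $(a,b,d)\in\mathbf{C}$. A space $X$ is weakly cyclically orderable if there is a cyclic order $\mathbf{C}$ on $X$ such that for all $a,b\in X$ the interval $\{x\in X:(a,x,b)\in\mathbf{C}\}$ is open in $X$. *)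

theory Defs
  imports "HOL-Analysis.Analysis"
begin

definition closed_pairs :: "'a topology \<Rightarrow> 'a set set" where
  "closed_pairs Z = {S. closedin Z S \<and> S \<noteq> {} \<and> finite S \<and> card S \<le> 2}"

definition vietoris_basic :: "'a topology \<Rightarrow> 'a set set \<Rightarrow> 'a set set" where
  "vietoris_basic Z V = {S \<in> closed_pairs Z. S \<subseteq> \<Union>V \<and> (\<forall>U\<in>V. S \<inter> U \<noteq> {})}"

text \<open>The family consisting of the whole space alone yields all of \<^term>\<open>closed_pairs Z\<close>, so this
  is the underlying set of the generated topology.\<close>

definition vietoris2 :: "'a topology \<Rightarrow> 'a set topology" where
  "vietoris2 Z =
     topology_generated_by {vietoris_basic Z V | V. finite V \<and> (\<forall>U\<in>V. openin Z U)}"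

lemma topspace_vietoris2: "topspace (vietoris2 Z) = closed_pairs Z"
proof
  show "topspace (vietoris2 Z) \<subseteq> closed_pairs Z"
    by (auto simp: vietoris2_def vietoris_basic_def)
  have "closed_pairs Z \<subseteq> vietoris_basic Z {topspace Z}"
    by (auto simp: vietoris_basic_def closed_pairs_def dest: closedin_subset)
  moreover have "vietoris_basic Z {topspace Z}
      \<in> {vietoris_basic Z V | V. finite V \<and> (\<forall>U\<in>V. openin Z U)}"
    by blast
  ultimately show "closed_pairs Z \<subseteq> topspace (vietoris2 Z)"
    unfolding vietoris2_def topology_generated_by_topspace by blast
qed

definition weak_selection :: "'a topology \<Rightarrow> ('a set \<Rightarrow> 'a) \<Rightarrow> bool" where
  "weak_selection Z \<sigma> \<longleftrightarrow> (\<forall>S\<in>closed_pairs Z. \<sigma> S \<in> S)"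

definition cyclic_order_on :: "'a set \<Rightarrow> ('a \<times> 'a \<times> 'a) set \<Rightarrow> bool" where
  "cyclic_order_on A C \<longleftrightarrow>
     C \<subseteq> A \<times> A \<times> A \<and>
     (\<forall>a\<in>A. \<forall>b\<in>A. \<forall>c\<in>A.
        (a \<noteq> b \<and> b \<noteq> c \<and> a \<noteq> c \<and> (a, b, c) \<notin> C) \<longleftrightarrow> (c, b, a) \<in> C) \<and>
     (\<forall>a\<in>A. \<forall>b\<in>A. \<forall>c\<in>A. (a, b, c) \<in> C \<longrightarrow> (b, c, a) \<in> C) \<and>
     (\<forall>a\<in>A. \<forall>b\<in>A. \<forall>c\<in>A. \<forall>d\<in>A.
        (a, b, c) \<in> C \<and> (a, c, d) \<in> C \<longrightarrow> (a, b, d) \<in> C)"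

definition weakly_cyclically_orderable :: "'a topology \<Rightarrow> bool" where
  "weakly_cyclically_orderable X \<longleftrightarrow>
     (\<exists>C. cyclic_order_on (topspace X) C \<and>
        (\<forall>a\<in>topspace X. \<forall>b\<in>topspace X. openin X {x \<in> topspace X. (a, x, b) \<in> C}))"

end

theory Submission
  imports Defs
begin

text \<open>
  A cyclic order cut open at \<open>p\<close> is a linear order on \<open>X - {p}\<close> with open rays, and its minimum is a
  continuous weak selection. Conversely, a continuous weak selection is a tournament with open
  rays, and on a connected space connectedness of rays forces it to be transitive and unique up to
  reversal. If some \<open>p\<close> separates \<open>X\<close> into \<open>U\<close> and \<open>V\<close>, a triod argument makes \<open>p\<close> an end point of
  \<open>U \<union> {p}\<close> and of \<open>V \<union> {p}\<close>, and the two orders are glued to a linear order on \<open>X\<close>. Otherwise the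
  order on \<open>X - {p}\<close>, with \<open>p\<close> added on top, induces the cyclic order; that the intervals around
  \<open>p\<close> are open follows by comparing with the order on \<open>X - {q}\<close> for \<open>q\<close> below the interval.
\<close>

section \<open>Tournaments with open rays\<close>

text \<open>Read \<open>r x y\<close> as "x lies below y". Transitivity is left out because a weak
  selection yields only a tournament; on connected spaces it follows later.\<close>

definition open_tournament :: "'a topology \<Rightarrow> ('a \<Rightarrow> 'a \<Rightarrow> bool) \<Rightarrow> bool" where
  "open_tournament Z r \<longleftrightarrow>
     (\<forall>x\<in>topspace Z. \<forall>y\<in>topspace Z. r x y \<longleftrightarrow> x \<noteq> y \<and> \<not> r y x) \<and>
     (\<forall>x\<in>topspace Z. openin Z {y \<in> topspace Z. r y x} \<and> openin Z {y \<in> topspace Z. r x y})"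

lemma open_tournament_iff:
  "open_tournament Z r \<Longrightarrow> x \<in> topspace Z \<Longrightarrow> y \<in> topspace Z \<Longrightarrow> r x y \<longleftrightarrow> x \<noteq> y \<and> \<not> r y x"
  unfolding open_tournament_def by blast

lemma open_tournament_openin:
  assumes "open_tournament Z r" "x \<in> topspace Z"
  shows "openin Z {y \<in> topspace Z. r y x}" "openin Z {y \<in> topspace Z. r x y}"
  using assms unfolding open_tournament_def by blast+

lemma open_tournament_converse: "open_tournament Z r \<Longrightarrow> open_tournament Z (\<lambda>x y. r y x)"
  unfolding open_tournament_def by blast

lemma open_tournament_subtopology:
  assumes "open_tournament Z r"
  shows "open_tournament (subtopology Z S) r"
proof -
  have eq: "{y \<in> topspace (subtopology Z S). P y} = {y \<in> topspace Z. P y} \<inter> S" for P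
    by auto
  show ?thesis
    unfolding open_tournament_def eq
  proof (intro conjI ballI)
    fix x y assume "x \<in> topspace (subtopology Z S)" "y \<in> topspace (subtopology Z S)"
    then show "r x y \<longleftrightarrow> x \<noteq> y \<and> \<not> r y x"
      by (intro open_tournament_iff[OF assms]) auto
  next
    fix x assume "x \<in> topspace (subtopology Z S)"
    then have "x \<in> topspace Z" by simp
    then show "openin (subtopology Z S) ({y \<in> topspace Z. r y x} \<inter> S)"
      "openin (subtopology Z S) ({y \<in> topspace Z. r x y} \<inter> S)"
      using open_tournament_openin[OF assms] openin_subtopology_Int by blast+
  qed
qed

section \<open>Open tournaments on connected spaces\<close>

lemma connectedin_subset_cases:
  assumes "connectedin X S" "openin X U" "openin X V" "U \<inter> V \<inter> S = {}" "S \<subseteq> U \<union> V"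
  shows "S \<subseteq> U \<or> S \<subseteq> V"
  using assms unfolding connectedin by blast

text \<open>A separation of \<open>insert p U\<close> would spread to all of \<open>X\<close>: the
  piece missing \<open>p\<close> stays inside \<open>U\<close>, and the piece containing
  \<open>p\<close> absorbs \<open>V\<close>.\<close>

lemma connectedin_insert_open_side:
  assumes X: "connected_space X" and U: "openin X U" and V: "openin X V"
    and disj: "U \<inter> V = {}" and p: "p \<notin> U" "p \<notin> V" and top: "topspace X = insert p (U \<union> V)"
  shows "connectedin X (insert p U)"
proof -
  have False
    if E: "openin X E1" "openin X E2" "insert p U \<subseteq> E1 \<union> E2"
      "E1 \<inter> E2 \<inter> insert p U = {}" "E2 \<inter> insert p U \<noteq> {}" "p \<in> E1" for E1 E2
  proof -
    have "openin X (E2 \<inter> U)" "openin X (E1 \<union> V)"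
      using E U V by auto
    moreover have "topspace X \<subseteq> (E2 \<inter> U) \<union> (E1 \<union> V)" "(E2 \<inter> U) \<inter> (E1 \<union> V) = {}"
      "E2 \<inter> U \<noteq> {}" "E1 \<union> V \<noteq> {}"
      using E disj p top by auto
    ultimately show False
      using X unfolding connected_space_def by meson
  qed
  note * = this
  have "\<not> (\<exists>E1 E2. openin X E1 \<and> openin X E2 \<and> insert p U \<subseteq> E1 \<union> E2 \<and>
      E1 \<inter> E2 \<inter> insert p U = {} \<and> E1 \<inter> insert p U \<noteq> {} \<and> E2 \<inter> insert p U \<noteq> {})"
  proof clarify
    fix E1 E2
    assume E: "openin X E1" "openin X E2" "insert p U \<subseteq> E1 \<union> E2" "E1 \<inter> E2 \<inter> insert p U = {}"
      "E1 \<inter> insert p U \<noteq> {}" "E2 \<inter> insert p U \<noteq> {}"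
    then consider "p \<in> E1" | "p \<in> E2" by blast
    then show False
    proof cases
      case 1 then show ?thesis using *[of E1 E2] E by blast
    next
      case 2 then show ?thesis using *[of E2 E1] E by blast
    qed
  qed
  then show ?thesis
    unfolding connectedin using top by blast
qed

lemma connectedin_closed_ray:
  assumes Z: "connected_space Z" and r: "open_tournament Z r" and x: "x \<in> topspace Z"
  shows "connectedin Z (insert x {y \<in> topspace Z. r y x})"
proof (rule connectedin_insert_open_side[OF Z])
  show "openin Z {y \<in> topspace Z. r y x}" "openin Z {y \<in> topspace Z. r x y}"
    using open_tournament_openin[OF r x] by auto
qed (use x open_tournament_iff[OF r] in blast)+

text \<open>In a 3-cycle the closed ray above \<open>b\<close> is connected and misses
  \<open>a\<close>, so it lies on one side of \<open>a\<close>; but it contains \<open>b\<close>,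
  which is above \<open>a\<close>, and \<open>c\<close>, which is below.\<close>

lemma open_tournament_trans:
  assumes Z: "connected_space Z" and r: "open_tournament Z r"
    and abc: "a \<in> topspace Z" "b \<in> topspace Z" "c \<in> topspace Z" and "r a b" "r b c"
  shows "r a c"
proof (rule ccontr)
  assume n: "\<not> r a c"
  have ne: "a \<noteq> c" "r c a"
    using n abc \<open>r a b\<close> \<open>r b c\<close> open_tournament_iff[OF r] by blast+
  let ?S = "insert b {y \<in> topspace Z. r b y}"
  have "connectedin Z ?S"
    using connectedin_closed_ray[OF Z open_tournament_converse[OF r]] abc by blast
  then have "?S \<subseteq> {y \<in> topspace Z. r y a} \<or> ?S \<subseteq> {y \<in> topspace Z. r a y}"
  proof (rule connectedin_subset_cases)
    show "openin Z {y \<in> topspace Z. r y a}" "openin Z {y \<in> topspace Z. r a y}"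
      using open_tournament_openin[OF r abc(1)] by auto
  qed (use abc \<open>r a b\<close> open_tournament_iff[OF r] in blast)+
  then show False
    using abc ne \<open>r a b\<close> \<open>r b c\<close> open_tournament_iff[OF r] by blast
qed

text \<open>A union of connected closed rays through a common point \<open>y0\<close>: a point not
  below \<open>y0\<close> lies in its own closed ray, and a point below \<open>y0\<close> in that of
  \<open>y0\<close>.\<close>

lemma connectedin_open_ray:
  assumes Z: "connected_space Z" and r: "open_tournament Z r" and x: "x \<in> topspace Z"
  shows "connectedin Z {y \<in> topspace Z. r y x}"
proof (cases "{y \<in> topspace Z. r y x} = {}")
  case True
  then show ?thesis
    by (metis connectedin_empty)
next
  case False
  then obtain y0 where y0: "y0 \<in> topspace Z" "r y0 x" by auto
  let ?L = "\<lambda>y. insert y {z \<in> topspace Z. r z y}"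
  let ?I = "{y \<in> topspace Z. r y x \<and> (y0 = y \<or> r y0 y)}"
  have "connectedin Z (\<Union>y\<in>?I. ?L y)"
  proof (rule connectedin_Union)
    show "\<And>S. S \<in> ?L ` ?I \<Longrightarrow> connectedin Z S"
      using connectedin_closed_ray[OF Z r] by blast
    show "\<Inter>(?L ` ?I) \<noteq> {}"
      using y0 by blast
  qed
  moreover have "(\<Union>y\<in>?I. ?L y) = {y \<in> topspace Z. r y x}"
  proof (intro equalityI subsetI)
    fix z assume "z \<in> (\<Union>y\<in>?I. ?L y)"
    then show "z \<in> {y \<in> topspace Z. r y x}"
      using open_tournament_trans[OF Z r] x by blast
  next
    fix z assume z: "z \<in> {y \<in> topspace Z. r y x}"
    then consider "y0 = z" | "r y0 z" | "r z y0"
      using y0 open_tournament_iff[OF r] by blast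
    then show "z \<in> (\<Union>y\<in>?I. ?L y)"
      using y0 z by cases blast+
  qed
  ultimately show ?thesis by simp
qed

text \<open>If nothing lay between, the ray below \<open>b\<close> and the ray above
  \<open>a\<close> would be disjoint and would separate the space.\<close>

lemma open_tournament_dense:
  assumes Z: "connected_space Z" and r: "open_tournament Z r"
    and ab: "a \<in> topspace Z" "b \<in> topspace Z" "r a b"
  obtains c where "c \<in> topspace Z" "r a c" "r c b"
proof (rule ccontr)
  assume "\<not> thesis"
  then have n: "\<forall>c\<in>topspace Z. \<not> (r a c \<and> r c b)"
    using that by blast
  have o: "openin Z {y \<in> topspace Z. r y b}" "openin Z {y \<in> topspace Z. r a y}"
    using open_tournament_openin[OF r] ab by auto
  have "topspace Z \<subseteq> {y \<in> topspace Z. r y b} \<union> {y \<in> topspace Z. r a y}"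
    using ab open_tournament_iff[OF r] open_tournament_trans[OF Z r] by blast
  moreover have "{y \<in> topspace Z. r y b} \<inter> {y \<in> topspace Z. r a y} = {}"
    "{y \<in> topspace Z. r y b} \<noteq> {}" "{y \<in> topspace Z. r a y} \<noteq> {}"
    using n ab by blast+
  ultimately show False
    using o Z unfolding connected_space_def by meson
qed

text \<open>Each open \<open>r\<close>-ray at \<open>x\<close> is connected and misses
  \<open>x\<close>, so it lies on one \<open>s\<close>-side of \<open>x\<close>. Hence the two
  relations agree or are opposite at each point, and agreement at a single pair spreads to all
  points.\<close>

lemma open_tournament_unique:
  assumes Z: "connected_space Z" and r: "open_tournament Z r" and s: "open_tournament Z s"
  shows "(\<forall>x\<in>topspace Z. \<forall>y\<in>topspace Z. r x y \<longleftrightarrow> s x y) \<or>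
         (\<forall>x\<in>topspace Z. \<forall>y\<in>topspace Z. r x y \<longleftrightarrow> s y x)"
proof -
  let ?T = "topspace Z"
  have side: "(\<forall>y\<in>?T. r' y x \<longrightarrow> s' y x) \<or> (\<forall>y\<in>?T. r' y x \<longrightarrow> s' x y)"
    if r': "open_tournament Z r'" and s': "open_tournament Z s'" and x: "x \<in> ?T" for r' s' x
  proof -
    have "{y \<in> ?T. r' y x} \<subseteq> {y \<in> ?T. s' y x} \<or> {y \<in> ?T. r' y x} \<subseteq> {y \<in> ?T. s' x y}"
    proof (rule connectedin_subset_cases[OF connectedin_open_ray[OF Z r' x]])
      show "openin Z {y \<in> ?T. s' y x}" "openin Z {y \<in> ?T. s' x y}"
        using open_tournament_openin[OF s' x] by auto
    qed (use x open_tournament_iff[OF r'] open_tournament_iff[OF s'] in blast)+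
    then show ?thesis by blast
  qed
  \<comment> \<open>If \<open>x\<close> is extreme for \<open>s'\<close>, then all other points form
    one connected \<open>s'\<close>-ray, which must lie on one \<open>r'\<close>-side; so
    \<open>x\<close> is extreme for \<open>r'\<close> too.\<close>
  have no_collapse: "r' x y = r' x z"
    if r': "open_tournament Z r'" and s': "open_tournament Z s'" and x: "x \<in> ?T"
      and all: "\<forall>y\<in>?T. y \<noteq> x \<longrightarrow> s' y x" and yz: "y \<in> ?T" "z \<in> ?T" "y \<noteq> x" "z \<noteq> x"
    for r' s' x y z
  proof -
    have "{y \<in> ?T. s' y x} \<subseteq> {y \<in> ?T. r' y x} \<or> {y \<in> ?T. s' y x} \<subseteq> {y \<in> ?T. r' x y}"
      using side[OF s' r' x] by blast
    then show ?thesis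
      using all yz x open_tournament_iff[OF r'] by blast
  qed
  \<comment> \<open>The delicate case is that both \<open>r\<close>-rays at \<open>x\<close> land on
    the same \<open>s\<close>-side. Then \<open>x\<close> is extreme for both relations, and one of
    the alternatives still holds.\<close>
  have at: "(\<forall>y\<in>?T. r x y \<longleftrightarrow> s x y) \<or> (\<forall>y\<in>?T. r x y \<longleftrightarrow> s y x)" if x: "x \<in> ?T" for x
  proof -
    note ri = open_tournament_iff[OF r] and si = open_tournament_iff[OF s]
    have 1: "(\<forall>y\<in>?T. r y x \<longrightarrow> s y x) \<or> (\<forall>y\<in>?T. r y x \<longrightarrow> s x y)"
      using side[OF r s x] .
    have 2: "(\<forall>y\<in>?T. r x y \<longrightarrow> s x y) \<or> (\<forall>y\<in>?T. r x y \<longrightarrow> s y x)"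
      using side[OF open_tournament_converse[OF r] open_tournament_converse[OF s] x] .
    have 3: "\<forall>y\<in>?T. \<forall>z\<in>?T. y \<noteq> x \<longrightarrow> z \<noteq> x \<longrightarrow> r x y = r x z" if "\<forall>y\<in>?T. y \<noteq> x \<longrightarrow> s y x"
      using no_collapse[OF r s x that] by blast
    have 4: "\<forall>y\<in>?T. \<forall>z\<in>?T. y \<noteq> x \<longrightarrow> z \<noteq> x \<longrightarrow> r x y = r x z" if "\<forall>y\<in>?T. y \<noteq> x \<longrightarrow> s x y"
      using no_collapse[OF r open_tournament_converse[OF s] x] that by blast
    have xs: "r y x \<longleftrightarrow> y \<noteq> x \<and> \<not> r x y" "s y x \<longleftrightarrow> y \<noteq> x \<and> \<not> s x y"
      "\<not> r x x" "\<not> s x x" if "y \<in> ?T" for y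
      using ri si that x by blast+
    have const: "(\<forall>y\<in>?T. y \<noteq> x \<longrightarrow> r x y) \<or> (\<forall>y\<in>?T. \<not> r x y)"
      if "\<forall>y\<in>?T. \<forall>z\<in>?T. y \<noteq> x \<longrightarrow> z \<noteq> x \<longrightarrow> r x y = r x z"
      using that xs(3) by metis
    from 1 show ?thesis
    proof
      assume lower: "\<forall>y\<in>?T. r y x \<longrightarrow> s y x"
      from 2 show ?thesis
      proof
        assume "\<forall>y\<in>?T. r x y \<longrightarrow> s x y"
        then have "\<forall>y\<in>?T. r x y \<longleftrightarrow> s x y"
          using lower xs by metis
        then show ?thesis ..
      next
        assume "\<forall>y\<in>?T. r x y \<longrightarrow> s y x"
        then have s: "\<forall>y\<in>?T. y \<noteq> x \<longrightarrow> s y x"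
          using lower xs by metis
        show ?thesis
          using const[OF 3[OF s]] s xs by metis
      qed
    next
      assume lower: "\<forall>y\<in>?T. r y x \<longrightarrow> s x y"
      from 2 show ?thesis
      proof
        assume "\<forall>y\<in>?T. r x y \<longrightarrow> s y x"
        then have "\<forall>y\<in>?T. r x y \<longleftrightarrow> s y x"
          using lower xs by metis
        then show ?thesis ..
      next
        assume "\<forall>y\<in>?T. r x y \<longrightarrow> s x y"
        then have s: "\<forall>y\<in>?T. y \<noteq> x \<longrightarrow> s x y"
          using lower xs by metis
        show ?thesis
          using const[OF 4[OF s]] s xs by metis
      qed
    qed
  qed
  show ?thesis
  proof (cases "\<exists>x\<in>?T. \<exists>y\<in>?T. x \<noteq> y \<and> (r x y \<longleftrightarrow> s x y)")
    case True
    then obtain a b where ab: "a \<in> ?T" "b \<in> ?T" "a \<noteq> b" "r a b \<longleftrightarrow> s a b" by blast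
    \<comment> \<open>Agreement on a pair is symmetric in its points, so agreement at
      \<open>a\<close> passes to every \<open>x\<close> through the pair of \<open>x\<close> and
      \<open>a\<close>, and then to all pairs at \<open>x\<close>.\<close>
    have flip: "(r x y \<longleftrightarrow> s x y) \<longleftrightarrow> (r y x \<longleftrightarrow> s y x)" if "x \<in> ?T" "y \<in> ?T" for x y
      using open_tournament_iff[OF r] open_tournament_iff[OF s] that by blast
    have agree: "\<forall>y\<in>?T. r x y \<longleftrightarrow> s x y"
      if "x \<in> ?T" "y \<in> ?T" "x \<noteq> y" "r x y \<longleftrightarrow> s x y" for x y
      using at[OF that(1)] that open_tournament_iff[OF s] by blast
    have "r x y \<longleftrightarrow> s x y" if "x \<in> ?T" "y \<in> ?T" for x y
    proof (cases "x = a")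
      case True
      then show ?thesis using agree[OF ab] that by blast
    next
      case False
      then have "r x a \<longleftrightarrow> s x a"
        using agree[OF ab] that ab flip by blast
      then show ?thesis
        using agree[OF that(1) ab(1) False] that by blast
    qed
    then show ?thesis by blast
  next
    case False
    have "r x y \<longleftrightarrow> s y x" if "x \<in> ?T" "y \<in> ?T" for x y
      using False that open_tournament_iff[OF r that] open_tournament_iff[OF s that]
        open_tournament_iff[OF s that(2,1)] by metis
    then show ?thesis by blast
  qed
qed

section \<open>Weak selections\<close>

lemma closed_pairs_insert:
  assumes "t1_space Z" "x \<in> topspace Z" "y \<in> topspace Z"
  shows "{x, y} \<in> closed_pairs Z"
proof -
  have "closedin Z {x, y}"
    using assms t1_space_closedin_finite[of Z] by simp
  moreover have "card {x, y} \<le> 2"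
    by (simp add: card_insert_if)
  ultimately show ?thesis
    unfolding closed_pairs_def by simp
qed

lemma closed_pairsE:
  assumes "S \<in> closed_pairs Z"
  obtains x y where "x \<in> topspace Z" "y \<in> topspace Z" "S = {x, y}"
proof -
  have S: "S \<noteq> {}" "finite S" "card S \<le> 2" "S \<subseteq> topspace Z"
    using assms closedin_subset unfolding closed_pairs_def by blast+
  then have "card S = 1 \<or> card S = 2"
    by (metis One_nat_def Suc_1 card_0_eq le_Suc_eq le_zero_eq)
  then show ?thesis
    using that S by (auto simp: card_1_singleton_iff card_2_iff)
qed

lemma continuous_map_pair_vietoris2:
  assumes "t1_space Z" and x: "x \<in> topspace Z"
  shows "continuous_map Z (vietoris2 Z) (\<lambda>y. {x, y})"
  unfolding vietoris2_def
proof (rule continuous_on_generated_topo)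
  fix B assume "B \<in> {vietoris_basic Z V |V. finite V \<and> (\<forall>U\<in>V. openin Z U)}"
  then obtain V where V: "B = vietoris_basic Z V" "finite V" "\<And>U. U \<in> V \<Longrightarrow> openin Z U"
    by blast
  \<comment> \<open>The members of \<open>V\<close> containing \<open>x\<close> are already met by
    \<open>x\<close>; so \<open>y\<close> has to lie in each of the others, and somewhere in
    \<open>\<Union>V\<close>.\<close>
  have "(\<lambda>y. {x, y}) -` B \<inter> topspace Z =
      (if x \<in> \<Union>V then topspace Z \<inter> \<Inter>{U \<in> V. x \<notin> U} \<inter> \<Union>V else {})"
    unfolding V vietoris_basic_def using closed_pairs_insert[OF assms(1) x] by auto
  moreover have "openin Z (topspace Z \<inter> \<Inter>{U \<in> V. x \<notin> U})"
  proof (cases "{U \<in> V. x \<notin> U} = {}")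
    \<comment> \<open>The intersection of the empty family is \<open>UNIV\<close>; the factor
      \<open>topspace Z\<close> keeps the set open.\<close>
    case True
    show ?thesis
      unfolding True by simp
  next
    case False
    then show ?thesis
      using V by (intro openin_Int openin_topspace openin_Inter) auto
  qed
  moreover have "openin Z (\<Union>V)"
    using V by blast
  ultimately show "openin Z ((\<lambda>y. {x, y}) -` B \<inter> topspace Z)"
    by (simp add: openin_Int)
next
  show "(\<lambda>y. {x, y}) ` topspace Z \<subseteq> \<Union> {vietoris_basic Z V |V. finite V \<and> (\<forall>U\<in>V. openin Z U)}"
    using topspace_vietoris2[of Z] closed_pairs_insert[OF assms(1) x]
    unfolding vietoris2_def topology_generated_by_topspace by blast
qed

text \<open>The chosen point counts as the lower one. Fixing one point of a pair turns Vietoris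
  continuity into openness of the rays.\<close>

lemma open_tournament_of_selection:
  assumes H: "Hausdorff_space Z" and ws: "weak_selection Z \<sigma>"
    and cont: "continuous_map (vietoris2 Z) Z \<sigma>"
  shows "open_tournament Z (\<lambda>x y. x \<noteq> y \<and> \<sigma> {x, y} = x)"
proof -
  have t1: "t1_space Z"
    using H by (rule Hausdorff_imp_t1_space)
  have sel: "\<sigma> {x, y} = x \<or> \<sigma> {x, y} = y" if "x \<in> topspace Z" "y \<in> topspace Z" for x y
    using ws closed_pairs_insert[OF t1 that] unfolding weak_selection_def by blast
  have op: "openin Z {y \<in> topspace Z. \<sigma> {x, y} \<in> W}" if "x \<in> topspace Z" "openin Z W" for x W
    using continuous_map_compose[OF continuous_map_pair_vietoris2[OF t1 that(1)] cont]
      that(2) unfolding continuous_map_def o_def by blast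
  have left: "openin Z {y \<in> topspace Z. y \<noteq> x \<and> \<sigma> {y, x} = y}" if x: "x \<in> topspace Z" for x
  proof -
    have eq: "{y \<in> topspace Z. y \<noteq> x \<and> \<sigma> {y, x} = y} =
        {y \<in> topspace Z. \<sigma> {x, y} \<in> topspace Z - {x}}"
      using sel x by (auto simp: insert_commute)
    have "openin Z (topspace Z - {x})"
      by (rule openin_diff[OF openin_topspace closedin_t1_singleton[OF t1 x]])
    then show ?thesis
      unfolding eq by (rule op[OF x])
  qed
  \<comment> \<open>The singleton of \<open>x\<close> need not be open, so \<open>x\<close> and
    \<open>y\<close> are separated by \<open>U\<close> and \<open>V\<close>: for \<open>z\<close> in
    \<open>V\<close>, a value of \<sigma> in \<open>U\<close> cannot be \<open>z\<close> and must be
    \<open>x\<close>.\<close>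
  have right: "openin Z {y \<in> topspace Z. x \<noteq> y \<and> \<sigma> {x, y} = x}" if x: "x \<in> topspace Z" for x
  proof (subst openin_subopen, intro ballI)
    fix y assume "y \<in> {y \<in> topspace Z. x \<noteq> y \<and> \<sigma> {x, y} = x}"
    then have y: "y \<in> topspace Z" "x \<noteq> y" "\<sigma> {x, y} = x" by auto
    then obtain U V where UV: "openin Z U" "openin Z V" "x \<in> U" "y \<in> V" "U \<inter> V = {}"
      using H x unfolding Hausdorff_space_def disjnt_def by metis
    have "openin Z (V \<inter> {y \<in> topspace Z. \<sigma> {x, y} \<in> U})"
      using UV op[OF x] by blast
    moreover have "V \<inter> {y \<in> topspace Z. \<sigma> {x, y} \<in> U} \<subseteq> {y \<in> topspace Z. x \<noteq> y \<and> \<sigma> {x, y} = x}"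
    proof
      fix z assume z: "z \<in> V \<inter> {y \<in> topspace Z. \<sigma> {x, y} \<in> U}"
      then have "z \<noteq> x" "\<sigma> {x, z} \<noteq> z"
        using UV by auto
      then show "z \<in> {y \<in> topspace Z. x \<noteq> y \<and> \<sigma> {x, y} = x}"
        using sel[OF x, of z] z by auto
    qed
    ultimately show "\<exists>T. openin Z T \<and> y \<in> T \<and> T \<subseteq> {y \<in> topspace Z. x \<noteq> y \<and> \<sigma> {x, y} = x}"
      using y UV by (intro exI[of _ "V \<inter> {y \<in> topspace Z. \<sigma> {x, y} \<in> U}"]) auto
  qed
  have total: "(x \<noteq> y \<and> \<sigma> {x, y} = x) = (x \<noteq> y \<and> \<not> (y \<noteq> x \<and> \<sigma> {y, x} = y))"
    if "x \<in> topspace Z" "y \<in> topspace Z" for x y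
    using sel[OF that] insert_commute[of x y "{}"] by metis
  show ?thesis
    unfolding open_tournament_def by (intro conjI ballI total left right)
qed

text \<open>Selecting the minimum is continuous since, by transitivity, \<open>r x y\<close>
  persists on neighbourhoods of \<open>x\<close> and \<open>y\<close>.\<close>

lemma continuous_selection_of_open_tournament:
  assumes r: "open_tournament Z r"
    and trans: "\<And>x y z. x \<in> topspace Z \<Longrightarrow> y \<in> topspace Z \<Longrightarrow> z \<in> topspace Z \<Longrightarrow>
      r x y \<Longrightarrow> r y z \<Longrightarrow> r x z"
  shows "\<exists>\<sigma>. weak_selection Z \<sigma> \<and> continuous_map (vietoris2 Z) Z \<sigma>"
proof -
  note ri = open_tournament_iff[OF r]
  define \<sigma> where "\<sigma> S = (THE x. x \<in> S \<and> (\<forall>y\<in>S. y = x \<or> r x y))" for S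
  have \<sigma>: "\<sigma> {x, y} = x" if "x \<in> topspace Z" "y \<in> topspace Z" "x = y \<or> r x y" for x y
    unfolding \<sigma>_def using ri that by (intro the_equality) blast+
  have ws: "weak_selection Z \<sigma>"
    unfolding weak_selection_def
  proof
    fix S assume "S \<in> closed_pairs Z"
    then obtain x y where xy: "x \<in> topspace Z" "y \<in> topspace Z" "S = {x, y}"
      by (rule closed_pairsE)
    then have "\<sigma> {x, y} = x \<or> \<sigma> {y, x} = y"
      using \<sigma> ri by blast
    then show "\<sigma> S \<in> S"
      using xy by (auto simp: insert_commute)
  qed
  have basic: "openin (vietoris2 Z) (vietoris_basic Z V)" if "finite V" "\<forall>U\<in>V. openin Z U" for V
    unfolding vietoris2_def by (rule topology_generated_by_Basis) (use that in blast)
  have sub: "\<sigma> S \<in> topspace Z" if "S \<in> closed_pairs Z" for S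
    using that ws closedin_subset unfolding weak_selection_def closed_pairs_def by blast
  \<comment> \<open>A point \<open>z\<close> in between gives the two rays at \<open>z\<close>. If
    \<open>x\<close> and \<open>y\<close> are adjacent, the ray below \<open>y\<close> and the ray
    above \<open>x\<close> serve instead.\<close>
  have separate: "\<exists>U V. openin Z U \<and> openin Z V \<and> x \<in> U \<and> y \<in> V \<and> (\<forall>u\<in>U. \<forall>v\<in>V. r u v)"
    if xy: "x \<in> topspace Z" "y \<in> topspace Z" "r x y" for x y
  proof (cases "\<exists>z\<in>topspace Z. r x z \<and> r z y")
    case True
    then obtain z where z: "z \<in> topspace Z" "r x z" "r z y" by blast
    then show ?thesis
      using open_tournament_openin[OF r z(1)] xy trans[OF _ z(1)] by blast
  next
    case False
    have "r u v" if "u \<in> topspace Z" "r u y" "v \<in> topspace Z" "r x v" for u v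
    proof -
      have "u = x \<or> r u x"
        using False that ri xy by blast
      then show ?thesis
        using that xy trans by blast
    qed
    then show ?thesis
      using open_tournament_openin(1)[OF r xy(2)] open_tournament_openin(2)[OF r xy(1)] xy by blast
  qed
  have "openin (vietoris2 Z) {S \<in> topspace (vietoris2 Z). \<sigma> S \<in> W}" if W: "openin Z W" for W
  proof (subst openin_subopen, clarify)
    fix S assume S: "S \<in> topspace (vietoris2 Z)" "\<sigma> S \<in> W"
    let ?G = "{S \<in> topspace (vietoris2 Z). \<sigma> S \<in> W}"
    obtain x y where xy: "x \<in> topspace Z" "y \<in> topspace Z" "S = {x, y}" "x = y \<or> r x y"
    proof -
      obtain x y where "x \<in> topspace Z" "y \<in> topspace Z" "S = {x, y}"
        using S by (auto simp: topspace_vietoris2 elim: closed_pairsE)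
      then show ?thesis
        using that[of x y] that[of y x] ri by blast
    qed
    have "x \<in> W"
      using S \<sigma> xy by simp
    show "\<exists>T. openin (vietoris2 Z) T \<and> S \<in> T \<and> T \<subseteq> ?G"
    proof (cases "x = y")
      case True
      have "S \<in> vietoris_basic Z {W}"
        using S True xy \<open>x \<in> W\<close> by (auto simp: vietoris_basic_def topspace_vietoris2)
      moreover have "vietoris_basic Z {W} \<subseteq> ?G"
        using ws by (auto simp: vietoris_basic_def topspace_vietoris2 weak_selection_def)
      ultimately show ?thesis
        using basic[of "{W}"] W by blast
    next
      case False
      then obtain U V where UV: "openin Z U" "openin Z V" "x \<in> U" "y \<in> V" "\<forall>u\<in>U. \<forall>v\<in>V. r u v"
        using separate xy by metis
      \<comment> \<open>A pair meeting both sets consists of some \<open>u\<close> in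
        \<open>U \<inter> W\<close> and some \<open>v\<close> in \<open>V\<close>, so its minimum
        \<open>u\<close> stays in \<open>W\<close>.\<close>
      have "S \<in> vietoris_basic Z {U \<inter> W, V}"
        using S xy UV \<open>x \<in> W\<close> by (auto simp: vietoris_basic_def topspace_vietoris2)
      moreover have "vietoris_basic Z {U \<inter> W, V} \<subseteq> ?G"
      proof
        fix S' assume "S' \<in> vietoris_basic Z {U \<inter> W, V}"
        then have S': "S' \<in> closed_pairs Z" "S' \<inter> (U \<inter> W) \<noteq> {}" "S' \<inter> V \<noteq> {}"
          by (auto simp: vietoris_basic_def)
        then obtain u v where uv: "u \<in> S'" "u \<in> U" "u \<in> W" "v \<in> S'" "v \<in> V" by blast
        then have top: "u \<in> topspace Z" "v \<in> topspace Z" "r u v"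
          using UV openin_subset by blast+
        obtain a b where "S' = {a, b}"
          using closed_pairsE[OF S'(1)] by metis
        then have "S' = {u, v}"
          using uv top ri by blast
        then show "S' \<in> ?G"
          using \<sigma> top uv S' by (simp add: topspace_vietoris2)
      qed
      ultimately show ?thesis
        using basic[of "{U \<inter> W, V}"] W UV by blast
    qed
  qed
  then have "continuous_map (vietoris2 Z) Z \<sigma>"
    using sub by (auto simp: continuous_map_def topspace_vietoris2)
  then show ?thesis
    using ws by blast
qed

section \<open>From cyclic orders to selections and back\<close>

text \<open>Cutting at \<open>p\<close> orders the remaining points by
  \<open>(p, x, y) \<in> C\<close>. Axiom (i) makes this a tournament, axiom (iii) makes it
  transitive, and its rays are the cyclic intervals between \<open>p\<close> and
  \<open>x\<close>.\<close>

lemma selection_of_cyclic_order: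
  assumes t1: "t1_space X" and w: "weakly_cyclically_orderable X" and p: "p \<in> topspace X"
  shows "\<exists>\<sigma>. weak_selection (subtopology X (topspace X - {p})) \<sigma> \<and>
       continuous_map (vietoris2 (subtopology X (topspace X - {p})))
         (subtopology X (topspace X - {p})) \<sigma>"
proof -
  let ?Z = "subtopology X (topspace X - {p})"
  obtain C where C: "cyclic_order_on (topspace X) C"
    and op: "\<And>a b. a \<in> topspace X \<Longrightarrow> b \<in> topspace X \<Longrightarrow> openin X {x \<in> topspace X. (a, x, b) \<in> C}"
    using w unfolding weakly_cyclically_orderable_def by blast
  have C1: "a \<noteq> b \<and> b \<noteq> c \<and> a \<noteq> c \<and> (a, b, c) \<notin> C \<longleftrightarrow> (c, b, a) \<in> C"
    and C2: "(a, b, c) \<in> C \<Longrightarrow> (b, c, a) \<in> C"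
    if "a \<in> topspace X" "b \<in> topspace X" "c \<in> topspace X" for a b c
    using C that unfolding cyclic_order_on_def by blast+
  have C3: "(a, b, d) \<in> C" if "a \<in> topspace X" "b \<in> topspace X" "c \<in> topspace X" "d \<in> topspace X"
    "(a, b, c) \<in> C" "(a, c, d) \<in> C" for a b c d
    using C that unfolding cyclic_order_on_def by blast
  have rot: "(a, b, c) \<in> C \<longleftrightarrow> (b, c, a) \<in> C"
    if "a \<in> topspace X" "b \<in> topspace X" "c \<in> topspace X" for a b c
    using C2[OF that] C2[OF that(2,3,1)] C2[OF that(3,1,2)] by blast
  have top: "topspace ?Z = topspace X - {p}" by auto
  have pop: "openin ?Z {y \<in> topspace ?Z. (a, y, b) \<in> C}"
    if "a \<in> topspace X" "b \<in> topspace X" for a b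
  proof -
    have eq: "{y \<in> topspace ?Z. (a, y, b) \<in> C} = {y \<in> topspace X. (a, y, b) \<in> C} \<inter> (topspace X - {p})"
      by auto
    show ?thesis
      unfolding eq by (rule openin_subtopology_Int[OF op[OF that]])
  qed
  have "open_tournament ?Z (\<lambda>x y. (p, x, y) \<in> C)"
    unfolding open_tournament_def
  proof (intro conjI ballI)
    fix x y assume "x \<in> topspace ?Z" "y \<in> topspace ?Z"
    then have xy: "x \<in> topspace X" "y \<in> topspace X" "x \<noteq> p" "y \<noteq> p" by auto
    have "(p, x, y) \<in> C \<longleftrightarrow> y \<noteq> x \<and> x \<noteq> p \<and> y \<noteq> p \<and> (y, x, p) \<notin> C"
      using C1 xy p by blast
    moreover have "(y, x, p) \<in> C \<longleftrightarrow> (p, y, x) \<in> C"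
      using rot xy p by blast
    ultimately show "((p, x, y) \<in> C) = (x \<noteq> y \<and> (p, y, x) \<notin> C)"
      using xy by blast
  next
    fix x assume "x \<in> topspace ?Z"
    then have x: "x \<in> topspace X" by auto
    show "openin ?Z {y \<in> topspace ?Z. (p, y, x) \<in> C}"
      using pop p x by blast
    have "{y \<in> topspace ?Z. (p, x, y) \<in> C} = {y \<in> topspace ?Z. (x, y, p) \<in> C}"
      using rot p x by auto
    then show "openin ?Z {y \<in> topspace ?Z. (p, x, y) \<in> C}"
      using pop[OF x p] by simp
  qed
  then show ?thesis
  proof (rule continuous_selection_of_open_tournament)
    fix x y z
    assume "x \<in> topspace ?Z" "y \<in> topspace ?Z" "z \<in> topspace ?Z" "(p, x, y) \<in> C" "(p, y, z) \<in> C"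
    then show "(p, x, z) \<in> C"
      using C3 p by (metis DiffD1 top)
  qed
qed

text \<open>A triple is cyclically ordered when some rotation of it is increasing. Openness is asked
  of intervals and of complements of closed intervals, not of rays: with a point of a circle put on
  top, upper rays are not open.\<close>

lemma weakly_cyclically_orderable_of_linear:
  assumes ri: "\<And>x y. x \<in> topspace X \<Longrightarrow> y \<in> topspace X \<Longrightarrow> r x y \<longleftrightarrow> x \<noteq> y \<and> \<not> r y x"
    and trans: "\<And>x y z. x \<in> topspace X \<Longrightarrow> y \<in> topspace X \<Longrightarrow> z \<in> topspace X \<Longrightarrow>
      r x y \<Longrightarrow> r y z \<Longrightarrow> r x z"
    and inner: "\<And>a b. a \<in> topspace X \<Longrightarrow> b \<in> topspace X \<Longrightarrow> r a b \<Longrightarrow>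
      openin X {x \<in> topspace X. r a x \<and> r x b}"
    and outer: "\<And>a b. a \<in> topspace X \<Longrightarrow> b \<in> topspace X \<Longrightarrow> r a b \<Longrightarrow>
      openin X {x \<in> topspace X. r x a \<or> r b x}"
  shows "weakly_cyclically_orderable X"
proof -
  let ?T = "topspace X"
  define C where "C = {(a, b, c). a \<in> ?T \<and> b \<in> ?T \<and> c \<in> ?T \<and>
    (r a b \<and> r b c \<or> r b c \<and> r c a \<or> r c a \<and> r a b)}"
  have C: "(a, b, c) \<in> C \<longleftrightarrow> r a b \<and> r b c \<or> r b c \<and> r c a \<or> r c a \<and> r a b"
    if "a \<in> ?T" "b \<in> ?T" "c \<in> ?T" for a b c
    using that unfolding C_def by simp
  have "cyclic_order_on ?T C"
    unfolding cyclic_order_on_def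
  proof (intro conjI ballI)
    show "C \<subseteq> ?T \<times> ?T \<times> ?T"
      unfolding C_def by blast
  next
    fix a b c assume abc: "a \<in> ?T" "b \<in> ?T" "c \<in> ?T"
    show "(a \<noteq> b \<and> b \<noteq> c \<and> a \<noteq> c \<and> (a, b, c) \<notin> C) = ((c, b, a) \<in> C)"
      unfolding C[OF abc] C[OF abc(3,2,1)]
      using ri[OF abc(1,2)] ri[OF abc(2,3)] ri[OF abc(1,3)] ri[OF abc(2,1)] ri[OF abc(3,2)]
        ri[OF abc(3,1)] trans[OF abc] trans[OF abc(3,2,1)] by (smt (verit))
    show "(a, b, c) \<in> C \<longrightarrow> (b, c, a) \<in> C"
      using C abc by blast
  next
    fix a b c d assume abcd: "a \<in> ?T" "b \<in> ?T" "c \<in> ?T" "d \<in> ?T"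
    show "(a, b, c) \<in> C \<and> (a, c, d) \<in> C \<longrightarrow> (a, b, d) \<in> C"
      unfolding C[OF abcd(1,2,3)] C[OF abcd(1,3,4)] C[OF abcd(1,2,4)]
      using abcd ri trans by blast
  qed
  moreover have "openin X {x \<in> ?T. (a, x, b) \<in> C}" if ab: "a \<in> ?T" "b \<in> ?T" for a b
  proof -
    consider "a = b" | "r a b" "\<not> r b a" | "r b a" "\<not> r a b"
      using ri ab by blast
    then show ?thesis
    proof cases
      case 1
      then have "{x \<in> ?T. (a, x, b) \<in> C} = {}"
        using C ab ri by blast
      then show ?thesis
        by (simp only: openin_empty)
    next
      case 2
      then have "{x \<in> ?T. (a, x, b) \<in> C} = {x \<in> ?T. r a x \<and> r x b}"
        using C ab by blast
      then show ?thesis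
        using inner[OF ab 2(1)] by simp
    next
      case 3
      then have "{x \<in> ?T. (a, x, b) \<in> C} = {x \<in> ?T. r x b \<or> r a x}"
        using C ab by blast
      then show ?thesis
        using outer[OF ab(2,1) 3(1)] by simp
    qed
  qed
  ultimately show ?thesis
    unfolding weakly_cyclically_orderable_def by blast
qed

section \<open>Spaces with a cut point\<close>

text \<open>The point \<open>p\<close> has only two rays. A part of \<open>V\<close> attached to
  \<open>p\<close> takes up one, so \<open>U\<close> fits into the other; reversing the order if
  necessary puts \<open>p\<close> on top.\<close>

lemma order_with_cut_point_on_top:
  assumes X: "connected_space X"
    and ot: "\<And>q. q \<in> topspace X \<Longrightarrow> \<exists>r. open_tournament (subtopology X (topspace X - {q})) r"
    and U: "openin X U" and V: "openin X V" and disj: "U \<inter> V = {}" and p: "p \<notin> U" "p \<notin> V"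
    and top: "topspace X = insert p (U \<union> V)" and ne: "U \<noteq> {}" "V \<noteq> {}"
  shows "\<exists>r. open_tournament (subtopology X (insert p U)) r \<and> (\<forall>u\<in>U. r u p)"
proof -
  have cU: "connectedin X (insert p U)"
    using connectedin_insert_open_side[OF X U V disj p top] .
  have cV: "connectedin X (insert p V)"
    using connectedin_insert_open_side[OF X V U] disj p top by blast
  \<comment> \<open>Any set that misses a point \<open>q\<close> inherits a tournament from
    \<open>X - {q}\<close>; the point \<open>q\<close> is taken on the opposite side of
    \<open>p\<close>.\<close>
  have sub: "\<exists>r. open_tournament (subtopology X S) r" if q: "q \<in> topspace X" "q \<notin> S" "S \<subseteq> topspace X" for q S
  proof -
    obtain r where "open_tournament (subtopology X (topspace X - {q})) r"
      using ot[OF q(1)] by blast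
    then have "open_tournament (subtopology (subtopology X (topspace X - {q})) S) r"
      by (rule open_tournament_subtopology)
    moreover have "(topspace X - {q}) \<inter> S = S"
      using q by blast
    ultimately show ?thesis
      by (auto simp: subtopology_subtopology)
  qed
  obtain u v where u: "u \<in> U" and v: "v \<in> V"
    using ne by blast
  let ?V = "subtopology X (insert p V)"
  have tV: "topspace ?V = insert p V"
    using top by auto
  have conV: "connected_space ?V"
    using cV by (simp add: connectedin_def)
  obtain s0 where s0: "open_tournament ?V s0"
    using sub[of u "insert p V"] u p disj top by blast
  then obtain s where s: "open_tournament ?V s" and pv: "s p v"
    using open_tournament_iff[OF s0, of p v] open_tournament_converse[OF s0] v p tV by blast
  \<comment> \<open>The order on \<open>X - {v}\<close> restricts to the connected set \<open>U \<union> P\<close>, in which \<open>p\<close> has at most two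
    sides; as \<open>P - {p}\<close> occupies one of them, all of \<open>U\<close> lies on the other.\<close>
  obtain P where P: "connectedin X P" "p \<in> P" "P \<subseteq> insert p V" "v \<notin> P" "P \<inter> V \<noteq> {}"
  proof -
    \<comment> \<open>The closed ray below such a \<open>w\<close> is connected, contains
      \<open>p\<close> and the point \<open>w\<close> of \<open>V\<close>, and omits
      \<open>v\<close>.\<close>
    obtain w where w: "w \<in> topspace ?V" "s p w" "s w v"
      using open_tournament_dense[OF conV s _ _ pv] tV v by blast
    let ?P = "insert w {y \<in> topspace ?V. s y w}"
    have "connectedin X ?P"
      using connectedin_closed_ray[OF conV s w(1)] connectedin_subtopology by blast
    moreover have "p \<in> ?P" "?P \<subseteq> insert p V"
      using w tV by auto
    moreover have "v \<notin> ?P" "w \<noteq> p"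
      using open_tournament_iff[OF s] w tV v by blast+
    ultimately show ?thesis
      using that[of ?P] w tV by blast
  qed
  let ?T = "U \<union> P"
  let ?Z = "subtopology X ?T"
  have tZ: "topspace ?Z = ?T"
    using P top by auto
  have "connectedin X (insert p U \<union> P)"
    using connectedin_Un[OF cU P(1)] P by blast
  moreover have "insert p U \<union> P = ?T"
    using P by blast
  ultimately have conZ: "connected_space ?Z"
    by (simp add: connectedin_def)
  obtain r where r: "open_tournament ?Z r"
    using sub[of v ?T] P v disj top by blast
  note ri = open_tournament_iff[OF r, unfolded tZ]
  let ?L = "{y \<in> ?T. r y p}" and ?R = "{y \<in> ?T. r p y}"
  have pT: "p \<in> ?T"
    using P by blast
  have side: "S \<subseteq> U \<or> S \<subseteq> V" if "connectedin ?Z S" "p \<notin> S" for S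
  proof (rule connectedin_subset_cases[OF _ U V])
    show "connectedin X S"
      using that connectedin_subtopology by blast
    show "S \<subseteq> U \<union> V"
      using that connectedin_subset_topspace[OF that(1)] tZ P by blast
  qed (use disj in blast)
  have "\<not> r p p"
    using ri pT by blast
  \<comment> \<open>A point of \<open>P \<inter> V\<close> lies in \<open>L\<close> or
    \<open>R\<close> and forces that set into \<open>V\<close>, leaving the other to contain all of
    \<open>U\<close>.\<close>
  have halves: "U \<subseteq> L \<or> U \<subseteq> R"
    if "L \<subseteq> U \<or> L \<subseteq> V" "R \<subseteq> U \<or> R \<subseteq> V" "U \<subseteq> L \<union> R" "P \<inter> V \<subseteq> L \<union> R" for L R
    using that P(5) ne disj by blast
  have "?L \<subseteq> U \<or> ?L \<subseteq> V"
    using connectedin_open_ray[OF conZ r, unfolded tZ, OF pT] \<open>\<not> r p p\<close> by (intro side) auto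
  moreover have "?R \<subseteq> U \<or> ?R \<subseteq> V"
    using connectedin_open_ray[OF conZ open_tournament_converse[OF r], unfolded tZ, OF pT]
      \<open>\<not> r p p\<close> by (intro side) auto
  moreover have "U \<subseteq> ?L \<union> ?R" "P \<inter> V \<subseteq> ?L \<union> ?R"
    using ri pT p by blast+
  ultimately have "U \<subseteq> ?L \<or> U \<subseteq> ?R"
    by (rule halves)
  moreover have "subtopology ?Z (insert p U) = subtopology X (insert p U)"
    using P by (simp add: subtopology_subtopology Int_absorb1)
  then have "open_tournament (subtopology X (insert p U)) r"
    "open_tournament (subtopology X (insert p U)) (\<lambda>x y. r y x)"
    using open_tournament_subtopology[OF r, of "insert p U"] open_tournament_converse by metis+
  ultimately show ?thesis
    by blast
qed

text \<open>The order on \<open>insert p U\<close> with \<open>p\<close> greatest is followed by one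
  on \<open>insert p V\<close> with \<open>p\<close> least; both keep \<open>p\<close> in common,
  and the rays of the result are open in \<open>X\<close>.\<close>

lemma weakly_cyclically_orderable_cut_point:
  assumes X: "connected_space X"
    and ot: "\<And>q. q \<in> topspace X \<Longrightarrow> \<exists>r. open_tournament (subtopology X (topspace X - {q})) r"
    and U: "openin X U" and V: "openin X V" and disj: "U \<inter> V = {}" and p: "p \<notin> U" "p \<notin> V"
    and top: "topspace X = insert p (U \<union> V)" and ne: "U \<noteq> {}" "V \<noteq> {}"
  shows "weakly_cyclically_orderable X"
proof -
  obtain r where r: "open_tournament (subtopology X (insert p U)) r" and rp: "\<And>u. u \<in> U \<Longrightarrow> r u p"
    using order_with_cut_point_on_top[OF X ot U V disj p top ne] by blast
  obtain s' where s': "open_tournament (subtopology X (insert p V)) s'" "\<And>v. v \<in> V \<Longrightarrow> s' v p"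
    using order_with_cut_point_on_top[OF X ot V U _ p(2,1) _ ne(2,1)] disj top by blast
  define s where "s = (\<lambda>x y. s' y x)"
  have s: "open_tournament (subtopology X (insert p V)) s" and sp: "\<And>v. v \<in> V \<Longrightarrow> s p v"
    unfolding s_def using s' open_tournament_converse by blast+
  have tU: "topspace (subtopology X (insert p U)) = insert p U"
    and tV: "topspace (subtopology X (insert p V)) = insert p V"
    using top by auto
  note ri = open_tournament_iff[OF r, unfolded tU] and si = open_tournament_iff[OF s, unfolded tV]
  \<comment> \<open>A relatively open set missing \<open>p\<close> lies inside the open set
    \<open>A\<close>, hence is open in \<open>X\<close>.\<close>
  have shrink: "openin X G"
    if G: "openin (subtopology X (insert p A)) G" and A: "openin X A" and "p \<notin> G" for A G
  proof -
    obtain W where W: "openin X W" "G = W \<inter> insert p A"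
      using G unfolding openin_subtopology by blast
    then have "G = W \<inter> A"
      using \<open>p \<notin> G\<close> by blast
    then show ?thesis
      using W A by blast
  qed
  \<comment> \<open>The set \<open>G\<close> may contain \<open>p\<close>: an open \<open>W\<close>
    inducing \<open>G\<close> exceeds it only by points of \<open>B\<close>, which are added
    anyway.\<close>
  have extend: "openin X (G \<union> B)"
    if G: "openin (subtopology X (insert p A)) G" and B: "openin X B"
      and top': "topspace X = insert p (A \<union> B)" for A B G
  proof -
    obtain W where W: "openin X W" "G = W \<inter> insert p A"
      using G unfolding openin_subtopology by blast
    then have "G \<union> B = W \<union> B"
      using openin_subset[OF W(1)] top' by blast
    then show ?thesis
      using openin_Un[OF W(1) B] by simp
  qed
  define t where "t x y \<longleftrightarrow> x \<in> insert p U \<and> y \<in> insert p U \<and> r x y \<or>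
    x \<in> insert p V \<and> y \<in> insert p V \<and> s x y \<or> x \<in> U \<and> y \<in> V" for x y
  have tUU: "t x y \<longleftrightarrow> r x y" if "x \<in> insert p U" "y \<in> insert p U" for x y
    using that disj p ri[of p p] si[of p p] unfolding t_def by blast
  have tVV: "t x y \<longleftrightarrow> s x y" if "x \<in> insert p V" "y \<in> insert p V" for x y
    using that disj p ri[of p p] si[of p p] unfolding t_def by blast
  have tUV: "t x y" "\<not> t y x" if "x \<in> U" "y \<in> V" for x y
    using that disj p unfolding t_def by blast+
  note rays = open_tournament_openin[OF r, unfolded tU] open_tournament_openin[OF s, unfolded tV]
  have t: "open_tournament X t"
    unfolding open_tournament_def
  proof (intro conjI ballI)
    fix x y assume "x \<in> topspace X" "y \<in> topspace X"
    then consider "x \<in> insert p U" "y \<in> insert p U" | "x \<in> insert p V" "y \<in> insert p V"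
      | "x \<in> U" "y \<in> V" | "x \<in> V" "y \<in> U"
      using top by blast
    then show "t x y = (x \<noteq> y \<and> \<not> t y x)"
    proof cases
      case 1
      then show ?thesis
        using tUU[OF 1] tUU[OF 1(2,1)] ri[OF 1] by blast
    next
      case 2
      then show ?thesis
        using tVV[OF 2] tVV[OF 2(2,1)] si[OF 2] by blast
    next
      case 3
      then show ?thesis
        using tUV[OF 3] disj by blast
    next
      case 4
      then show ?thesis
        using tUV[OF 4(2,1)] disj by blast
    qed
  next
    fix x assume "x \<in> topspace X"
    then consider "x = p" | "x \<in> U" | "x \<in> V"
      using top by blast
    then have "openin X {y \<in> topspace X. t y x} \<and> openin X {y \<in> topspace X. t x y}"
    proof cases
      case 1
      have "t u p" "\<not> t p u" if "u \<in> U" for u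
        using tUU[of u p] tUU[of p u] ri[of u p] rp[OF that] that by auto
      moreover have "t p v" "\<not> t v p" if "v \<in> V" for v
        using tVV[of v p] tVV[of p v] si[of p v] sp[OF that] that by auto
      moreover have "\<not> t p p"
        using tUU[of p p] ri[of p p] by auto
      ultimately have "{y \<in> topspace X. t y x} = U" "{y \<in> topspace X. t x y} = V"
        unfolding 1 top by auto
      then show ?thesis
        using U V by simp
    next
      case 2
      \<comment> \<open>The ray pointing away from \<open>p\<close> stays within \<open>U\<close>;
        the other one passes through \<open>p\<close> and takes in all of \<open>V\<close>.\<close>
      have "{y \<in> topspace X. t y x} = {y \<in> insert p U. r y x}"
        "{y \<in> topspace X. t x y} = {y \<in> insert p U. r x y} \<union> V"
        unfolding top using tUU tUV 2 disj p by blast+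
      moreover have "p \<notin> {y \<in> insert p U. r y x}"
        using rp[OF 2] ri[of p x] 2 by blast
      ultimately show ?thesis
        using shrink[OF rays(1) U] extend[OF rays(2) V top] 2 by auto
    next
      case 3
      have "{y \<in> topspace X. t x y} = {y \<in> insert p V. s x y}"
        "{y \<in> topspace X. t y x} = {y \<in> insert p V. s y x} \<union> U"
        unfolding top using tVV tUV 3 disj p by blast+
      moreover have "p \<notin> {y \<in> insert p V. s x y}"
        using sp[OF 3] si[of p x] 3 by blast
      moreover have "topspace X = insert p (V \<union> U)"
        using top by blast
      ultimately show ?thesis
        using shrink[OF rays(4) V] extend[OF rays(3) U] 3 by auto
    qed
    then show "openin X {y \<in> topspace X. t y x}" "openin X {y \<in> topspace X. t x y}" by auto
  qed
  show ?thesis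
  proof (rule weakly_cyclically_orderable_of_linear)
    fix a b assume ab: "a \<in> topspace X" "b \<in> topspace X"
    have "{x \<in> topspace X. t a x \<and> t x b} = {x \<in> topspace X. t a x} \<inter> {x \<in> topspace X. t x b}"
      "{x \<in> topspace X. t x a \<or> t b x} = {x \<in> topspace X. t x a} \<union> {x \<in> topspace X. t b x}"
      by blast+
    then show "openin X {x \<in> topspace X. t a x \<and> t x b}" "openin X {x \<in> topspace X. t x a \<or> t b x}"
      using open_tournament_openin[OF t] ab by auto
  \<comment> \<open>Transitivity of the glued relation comes from connectedness of \<open>X\<close>
    instead of a case analysis.\<close>
  qed (fact open_tournament_iff[OF t] open_tournament_trans[OF X t])+
qed

section \<open>Spaces without cut points\<close>

text \<open>Seen from above \<open>q\<close>, the missing point \<open>p\<close> acts as an upper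
  end of \<open>r\<close>. This is read off from the order on \<open>X - {q}\<close>, where
  \<open>p\<close> is present and which, on the connected ray above \<open>q\<close>, equals
  \<open>r\<close> or its reverse.\<close>

lemma punctured_limit:
  assumes nocut: "\<And>q. q \<in> topspace X \<Longrightarrow> connectedin X (topspace X - {q})"
    and t1: "t1_space X"
    and pq: "p \<in> topspace X" "q \<in> topspace X" "p \<noteq> q"
    and r: "open_tournament (subtopology X (topspace X - {p})) r"
    and s: "open_tournament (subtopology X (topspace X - {q})) s"
    and x: "x \<in> topspace X - {p}" "r q x"
  shows "\<exists>W. openin X W \<and> p \<in> W \<and> (\<forall>y\<in>W. y \<noteq> p \<longrightarrow> r q y \<longrightarrow> r x y)"
proof -
  have top: "topspace (subtopology X (topspace X - {z})) = topspace X - {z}" for z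
    by auto
  have con: "connected_space (subtopology X (topspace X - {z}))" if "z \<in> topspace X" for z
    using nocut that by (simp add: connectedin_def)
  have opX: "openin X G" if "openin (subtopology X (topspace X - {z})) G" "z \<in> topspace X" for z G
    by (rule openin_trans_full[OF that(1)
          openin_diff[OF openin_topspace closedin_t1_singleton[OF t1 that(2)]]])
  let ?R = "{y \<in> topspace X - {p}. r q y}"
  note ri = open_tournament_iff[OF r, unfolded top]
  have q: "q \<in> topspace X - {p}" and p: "p \<in> topspace X - {q}"
    using pq by auto
  have cR: "connectedin X ?R"
    using connectedin_open_ray[OF con[OF pq(1)] open_tournament_converse[OF r]] q
    by (simp add: connectedin_subtopology)
  have oR: "openin X ?R"
    using opX[OF _ pq(1)] open_tournament_openin(2)[OF r, unfolded top] q by blast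
  \<comment> \<open>The ray above \<open>q\<close> is connected and contains neither
    \<open>p\<close> nor \<open>q\<close>, so it lies on one \<open>s\<close>-side of
    \<open>p\<close>; \<open>s'\<close> is \<open>s\<close> or its reverse, oriented to put that ray
    below \<open>p\<close>.\<close>
  obtain s' where s': "open_tournament (subtopology X (topspace X - {q})) s'"
    and sp: "\<And>y. y \<in> ?R \<Longrightarrow> s' y p"
  proof -
    have "?R \<subseteq> {y \<in> topspace X - {q}. s y p} \<or> ?R \<subseteq> {y \<in> topspace X - {q}. s p y}"
    proof (rule connectedin_subset_cases[OF cR])
      show "openin X {y \<in> topspace X - {q}. s y p}" "openin X {y \<in> topspace X - {q}. s p y}"
        using opX[OF open_tournament_openin(1)[OF s, unfolded top, OF p] pq(2)]
          opX[OF open_tournament_openin(2)[OF s, unfolded top, OF p] pq(2)] by simp_all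
      have sp: "s y p \<longleftrightarrow> y \<noteq> p \<and> \<not> s p y" if "y \<in> topspace X - {q}" for y
        using open_tournament_iff[OF s, unfolded top, OF that p] .
      show "{y \<in> topspace X - {q}. s y p} \<inter> {y \<in> topspace X - {q}. s p y} \<inter> ?R = {}"
        using sp by auto
      have "?R \<subseteq> topspace X - {q}"
        using ri[OF q q] by auto
      then show "?R \<subseteq> {y \<in> topspace X - {q}. s y p} \<union> {y \<in> topspace X - {q}. s p y}"
        using sp by auto
    qed
    then show ?thesis
      using that[OF s] that[OF open_tournament_converse[OF s]] by blast
  qed
  note si = open_tournament_iff[OF s', unfolded top]
  have Rq: "?R \<subseteq> topspace X - {q}"
    using ri q by blast
  have sub: "subtopology (subtopology X (topspace X - {z})) ?R = subtopology X ?R"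
    if "?R \<subseteq> topspace X - {z}" for z
    using that by (simp add: subtopology_subtopology Int_absorb1)
  have "?R \<subseteq> topspace X - {p}"
    by blast
  then have "open_tournament (subtopology X ?R) r" "open_tournament (subtopology X ?R) s'"
    using open_tournament_subtopology[OF r, of ?R] open_tournament_subtopology[OF s', of ?R]
    by (simp_all only: sub Rq)
  moreover have "connected_space (subtopology X ?R)" and tR: "topspace (subtopology X ?R) = ?R"
    using cR by (auto simp: connectedin_def)
  ultimately consider "\<forall>x\<in>?R. \<forall>y\<in>?R. r x y \<longleftrightarrow> s' x y" | "\<forall>x\<in>?R. \<forall>y\<in>?R. r x y \<longleftrightarrow> s' y x"
    using open_tournament_unique[of "subtopology X ?R" r s'] unfolding tR by blast
  then show ?thesis
  proof cases
    case 1
    \<comment> \<open>If the orders agree, the \<open>s'\<close>-ray above \<open>x\<close> is the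
      required neighbourhood of \<open>p\<close>.\<close>
    let ?W = "{y \<in> topspace X - {q}. s' x y}"
    have xR: "x \<in> ?R"
      using x by blast
    then have "openin X ?W"
      using opX[OF _ pq(2)] open_tournament_openin(2)[OF s', unfolded top] Rq by blast
    moreover have "p \<in> ?W"
      using sp[OF xR] p by blast
    moreover have "r x y" if "y \<in> ?W" "y \<noteq> p" "r q y" for y
      using 1 xR that by blast
    ultimately show ?thesis by blast
  next
    case 2
    \<comment> \<open>If they are opposite, a point \<open>z\<close> between \<open>q\<close> and
      \<open>x\<close> becomes a cut point: \<open>?G\<close> contains \<open>x\<close>,
      \<open>?L \<union> ?W\<close> contains \<open>p\<close>, and these open sets separate the
      complement of \<open>z\<close>.\<close>
    obtain z where z: "z \<in> topspace X - {p}" "r q z" "r z x"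
      using open_tournament_dense[OF con[OF pq(1)] r, unfolded top] q x by blast
    have zR: "z \<in> ?R"
      using z by blast
    have zq: "z \<in> topspace X - {q}"
      using zR Rq by blast
    let ?G = "{y \<in> topspace X - {p}. r z y}" and ?L = "{y \<in> topspace X - {p}. r y z}"
      and ?W = "{y \<in> topspace X - {q}. s' z y}"
    have o: "openin X ?G" "openin X ?L" "openin X ?W"
      using opX[OF open_tournament_openin(2)[OF r, unfolded top, OF z(1)] pq(1)]
        opX[OF open_tournament_openin(1)[OF r, unfolded top, OF z(1)] pq(1)]
        opX[OF open_tournament_openin(2)[OF s', unfolded top, OF zq] pq(2)] by simp_all
    have GR: "?G \<subseteq> ?R"
      using open_tournament_trans[OF con[OF pq(1)] r, unfolded top] q z by blast
    have W: "?G \<inter> ?W = {}"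
      using GR 2 zR Rq si by blast
    have pW: "p \<in> ?W"
      using sp[OF zR] p by blast
    have "topspace X - {z} \<subseteq> ?G \<or> topspace X - {z} \<subseteq> ?L \<union> ?W"
    proof (rule connectedin_subset_cases)
      show "connectedin X (topspace X - {z})"
        using nocut z by blast
      show "openin X ?G" "openin X (?L \<union> ?W)"
        using o by auto
      show "?G \<inter> (?L \<union> ?W) \<inter> (topspace X - {z}) = {}"
        using W ri z by blast
      show "topspace X - {z} \<subseteq> ?G \<union> (?L \<union> ?W)"
        using ri z pW by blast
    qed
    moreover have "p \<in> topspace X - {z}" "x \<in> topspace X - {z}" "x \<in> ?G"
      using p z x ri by blast+
    ultimately have False
      using W ri[of x z] x z by blast
    then show ?thesis ..
  qed
qed

text \<open>With \<open>p\<close> placed above the order of \<open>X - {p}\<close>, the only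
  openness not given by rays is that of the complement of a closed interval at \<open>p\<close>;
  \<open>punctured_limit\<close> provides it.\<close>

lemma weakly_cyclically_orderable_no_cut_point:
  assumes nocut: "\<And>q. q \<in> topspace X \<Longrightarrow> connectedin X (topspace X - {q})"
    and t1: "t1_space X"
    and ot: "\<And>q. q \<in> topspace X \<Longrightarrow> \<exists>r. open_tournament (subtopology X (topspace X - {q})) r"
  shows "weakly_cyclically_orderable X"
proof (cases "topspace X = {}")
  case True
  then show ?thesis
    \<comment> \<open>The empty space has no point to remove, so it is treated apart.\<close>
    by (intro weakly_cyclically_orderable_of_linear[where r = "\<lambda>_ _. False"]) auto
next
  case False
  then obtain p where p: "p \<in> topspace X" by blast
  obtain r where r: "open_tournament (subtopology X (topspace X - {p})) r"
    using ot[OF p] by blast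
  have top: "topspace (subtopology X (topspace X - {z})) = topspace X - {z}" for z
    by auto
  have con: "connected_space (subtopology X (topspace X - {p}))"
    using nocut[OF p] by (simp add: connectedin_def)
  have opX: "openin X G" if "openin (subtopology X (topspace X - {p})) G" for G
    by (rule openin_trans_full[OF that
          openin_diff[OF openin_topspace closedin_t1_singleton[OF t1 p]]])
  let ?A = "topspace X - {p}"
  note ri = open_tournament_iff[OF r, unfolded top]
  note rt = open_tournament_trans[OF con r, unfolded top]
  have rays: "openin X {y \<in> ?A. r y x}" "openin X {y \<in> ?A. r x y}" if "x \<in> ?A" for x
    using opX open_tournament_openin[OF r, unfolded top] that by blast+
  have limit: "\<exists>W. openin X W \<and> p \<in> W \<and> (\<forall>y\<in>W. y \<noteq> p \<longrightarrow> r q y \<longrightarrow> r x y)"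
    if "q \<in> ?A" "x \<in> ?A" "r q x" for q x
    using punctured_limit[OF nocut t1 p _ _ r] ot that by (metis DiffD1 DiffD2 singletonI)
  \<comment> \<open>If \<open>b\<close> were least, a neighbourhood \<open>W\<close> of
    \<open>p\<close> would have all its points other than \<open>p\<close> and \<open>b\<close>
    above \<open>a\<close>. Then \<open>W - {b}\<close> together with the ray above \<open>a\<close>
    splits off from the ray below \<open>a\<close>, making \<open>a\<close> a cut point.\<close>
  have no_min: "\<exists>q\<in>?A. r q b" if ab: "a \<in> ?A" "b \<in> ?A" "r b a" for a b
  proof (rule ccontr)
    assume "\<not> ?thesis"
    then have min: "y = b \<or> r b y" if "y \<in> ?A" for y
      using that ab ri by blast
    obtain W where W: "openin X W" "p \<in> W" "\<forall>y\<in>W. y \<noteq> p \<longrightarrow> r b y \<longrightarrow> r a y"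
      using limit[of b a] ab by blast
    let ?L = "{y \<in> ?A. r y a}" and ?R = "(W - {b}) \<union> {y \<in> ?A. r a y}"
    have "topspace X - {a} \<subseteq> ?L \<or> topspace X - {a} \<subseteq> ?R"
    proof (rule connectedin_subset_cases)
      show "connectedin X (topspace X - {a})"
        using nocut ab by blast
      show "openin X ?L"
        using rays ab by blast
      have "openin X (W - {b})"
        using openin_diff[OF W(1) closedin_t1_singleton[OF t1]] ab by blast
      then show "openin X ?R"
        using rays ab by blast
      show "?L \<inter> ?R \<inter> (topspace X - {a}) = {}"
        using W(3) min ri ab by blast
      show "topspace X - {a} \<subseteq> ?L \<union> ?R"
        using W(2) ab ri by blast
    qed
    moreover have "p \<in> topspace X - {a}" "b \<in> topspace X - {a}" "b \<notin> ?R" "p \<notin> ?L"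
      using p ab ri by blast+
    ultimately show False by blast
  qed
  define t where "t x y \<longleftrightarrow> x \<noteq> p \<and> (y = p \<or> r x y)" for x y
  show ?thesis
  proof (rule weakly_cyclically_orderable_of_linear)
    fix x y assume xy: "x \<in> topspace X" "y \<in> topspace X"
    then show "t x y \<longleftrightarrow> x \<noteq> y \<and> \<not> t y x"
      unfolding t_def using ri by blast
    fix z assume "z \<in> topspace X" "t x y" "t y z"
    then show "t x z"
      unfolding t_def using rt xy by blast
  next
    fix a b assume ab: "a \<in> topspace X" "b \<in> topspace X" "t a b"
    then have a: "a \<in> ?A"
      unfolding t_def by blast
    show "openin X {x \<in> topspace X. t a x \<and> t x b}"
    proof (cases "b = p")
      case True
      then have "{x \<in> topspace X. t a x \<and> t x b} = {x \<in> ?A. r a x}"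
        using a unfolding t_def by blast
      then show ?thesis
        using rays a by simp
    next
      case False
      then have "{x \<in> topspace X. t a x \<and> t x b} = {x \<in> ?A. r a x} \<inter> {x \<in> ?A. r x b}"
        using a unfolding t_def by blast
      then show ?thesis
        using rays a ab False by auto
    qed
    show "openin X {x \<in> topspace X. t x a \<or> t b x}"
    proof (cases "b = p")
      case True
      then have "{x \<in> topspace X. t x a \<or> t b x} = {x \<in> ?A. r x a}"
        using a unfolding t_def by blast
      then show ?thesis
        using rays a by simp
    next
      case False
      then have b: "b \<in> ?A" "r a b"
        using ab unfolding t_def by blast+
      \<comment> \<open>The point \<open>q\<close> has to lie strictly below \<open>a\<close>, so
        that \<open>a\<close> and everything above it belong to the ray above
        \<open>q\<close>.\<close>
      obtain q where q: "q \<in> ?A" "r q a"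
        using no_min b a by blast
      then have "r q b"
        using rt a b by blast
      then obtain W where W: "openin X W" "p \<in> W" "\<forall>y\<in>W. y \<noteq> p \<longrightarrow> r q y \<longrightarrow> r b y"
        using limit q b by blast
      have WX: "W \<subseteq> topspace X"
        using W(1) by (rule openin_subset)
      \<comment> \<open>A point of \<open>W\<close> other than \<open>p\<close> that is not below
        \<open>a\<close> lies above \<open>q\<close>, hence above \<open>b\<close>; so
        \<open>W\<close> misses the closed interval from \<open>a\<close> to
        \<open>b\<close>.\<close>
      have "r y a \<or> r b y" if "y \<in> W" "y \<noteq> p" for y
        using that W(3) WX ri rt q a by blast
      then have "{x \<in> topspace X. t x a \<or> t b x} = W \<union> {x \<in> ?A. r x a} \<union> {x \<in> ?A. r b x}"
        using a b W(2) WX unfolding t_def by blast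
      then show ?thesis
        using rays a b W by auto
    qed
  qed
qed

section \<open>The equivalence, split by the existence of a cut point\<close>

theorem theorem1p2:
  fixes X :: "'a topology"
  assumes "infinite (topspace X)"
    and "connected_space X"
    and "Hausdorff_space X"
  shows "weakly_cyclically_orderable X \<longleftrightarrow>
    (\<forall>p\<in>topspace X. \<exists>\<sigma>.
       weak_selection (subtopology X (topspace X - {p})) \<sigma> \<and>
       continuous_map (vietoris2 (subtopology X (topspace X - {p})))
         (subtopology X (topspace X - {p})) \<sigma>)"
  (is "_ \<longleftrightarrow> ?selections")
proof
  have t1: "t1_space X"
    using assms(3) by (rule Hausdorff_imp_t1_space)
  show ?selections if "weakly_cyclically_orderable X"
    using selection_of_cyclic_order[OF t1 that] by blast
  assume ?selections
  then have ot: "\<exists>r. open_tournament (subtopology X (topspace X - {q})) r" if "q \<in> topspace X" for q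
    using that open_tournament_of_selection Hausdorff_space_subtopology[OF assms(3)] by blast
  show "weakly_cyclically_orderable X"
  proof (cases "\<forall>q\<in>topspace X. connectedin X (topspace X - {q})")
    case True
    then show ?thesis
      using weakly_cyclically_orderable_no_cut_point[OF _ t1 ot] by blast
  next
    case False
    then obtain p where p: "p \<in> topspace X" "\<not> connectedin X (topspace X - {p})" by blast
    have oA: "openin X (topspace X - {p})"
      by (rule openin_diff[OF openin_topspace closedin_t1_singleton[OF t1 p(1)]])
    \<comment> \<open>Intersected with the open set \<open>X - {p}\<close>, the two parts of a
      separation become disjoint nonempty open sides of the cut point \<open>p\<close>.\<close>
    obtain E1 E2 where E: "openin X E1" "openin X E2" "topspace X - {p} \<subseteq> E1 \<union> E2"
      "E1 \<inter> E2 \<inter> (topspace X - {p}) = {}" "E1 \<inter> (topspace X - {p}) \<noteq> {}"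
      "E2 \<inter> (topspace X - {p}) \<noteq> {}"
      using p(2) unfolding connectedin by blast
    show ?thesis
    proof (rule weakly_cyclically_orderable_cut_point[OF assms(2) ot])
      show "openin X (E1 \<inter> (topspace X - {p}))" "openin X (E2 \<inter> (topspace X - {p}))"
        using E oA by auto
      show "topspace X = insert p (E1 \<inter> (topspace X - {p}) \<union> E2 \<inter> (topspace X - {p}))"
        using E(3) p(1) by blast
    qed (use E in auto)
  qed
qed

end
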